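(* Let $P\in\mathbb{C}^{n\times k}$ ($k\le n$) have full column rank and let $A,B$ be $n\times n$ Hermitian positive definite matrices. Then $$\delta_\Phi(P^*AP,P^*BP)\le\delta_\Phi(A,B),$$ where $\Phi$ is any symmetric gauge function on $\mathbb{R}^n$.
   Context: A symmetric gauge function $\Phi$ is a norm on $\mathbb{R}^n$ that is invariant under permutations of coordinates and absolute (depends only on the absolute values of the coordinates); it is applied to vectors in $\mathbb{R}^k$, $k\le n$, by padding with zeros. For Hermitian positive definite $X,Y$ of size $m\times m$ with $m\le n$, $\delta_\Phi(X,Y):=\Phi(\log\lambda_1,\dots,\log\lambda_m)$, where $\lambda_1,\dots,\lambda_m$ are the (positive) eigenvalues of $X^{-1}Y$ with multiplicity. $P^*$ is the conjugate transpose of $P$. *)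

theory Defs
  imports
    "Jordan_Normal_Form.Char_Poly"
    "Jordan_Normal_Form.Schur_Decomposition"
    "Jordan_Normal_Form.Gauss_Jordan_Elimination"
    "Jordan_Normal_Form.DL_Rank"
    "HOL-Combinatorics.Permutations"
begin

definition hermitian_mat :: "complex mat \<Rightarrow> bool" where
  "hermitian_mat A \<longleftrightarrow> mat_adjoint A = A"

(* (A *v v) \<bullet>c v is the sum of (A v)_i * cnj v_i, that is v^* A v.  This number is real
   because A is Hermitian, so only its real part has to be compared with 0. *)
definition positive_definite_mat :: "nat \<Rightarrow> complex mat \<Rightarrow> bool" where
  "positive_definite_mat n A \<longleftrightarrow>
     A \<in> carrier_mat n n \<and> hermitian_mat A \<and>
     (\<forall>v \<in> carrier_vec n. v \<noteq> 0\<^sub>v n \<longrightarrow> 0 < Re ((A *\<^sub>v v) \<bullet>c v))"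

definition norm_on_vec :: "nat \<Rightarrow> (real vec \<Rightarrow> real) \<Rightarrow> bool" where
  "norm_on_vec n \<Phi> \<longleftrightarrow>
     (\<forall>x \<in> carrier_vec n. 0 \<le> \<Phi> x) \<and>
     (\<forall>x \<in> carrier_vec n. \<Phi> x = 0 \<longleftrightarrow> x = 0\<^sub>v n) \<and>
     (\<forall>c. \<forall>x \<in> carrier_vec n. \<Phi> (c \<cdot>\<^sub>v x) = \<bar>c\<bar> * \<Phi> x) \<and>
     (\<forall>x \<in> carrier_vec n. \<forall>y \<in> carrier_vec n. \<Phi> (x + y) \<le> \<Phi> x + \<Phi> y)"

definition symmetric_gauge :: "nat \<Rightarrow> (real vec \<Rightarrow> real) \<Rightarrow> bool" where
  "symmetric_gauge n \<Phi> \<longleftrightarrow>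
     norm_on_vec n \<Phi> \<and>
     (\<forall>p x. p permutes {..<n} \<longrightarrow> x \<in> carrier_vec n \<longrightarrow> \<Phi> (vec n (\<lambda>i. x $ p i)) = \<Phi> x) \<and>
     (\<forall>x \<in> carrier_vec n. \<forall>y \<in> carrier_vec n.
        map_vec abs x = map_vec abs y \<longrightarrow> \<Phi> x = \<Phi> y)"

definition zero_pad :: "nat \<Rightarrow> real vec \<Rightarrow> real vec" where
  "zero_pad n v = v @\<^sub>v 0\<^sub>v (n - dim_vec v)"

definition eigenvalue_mset :: "complex mat \<Rightarrow> complex multiset" where
  "eigenvalue_mset A = proots (char_poly A)"

(* For X, Y positive definite, X is invertible (so mat_inverse is not None) and the eigenvalues
   of X^(-1) Y are positive reals; Re only converts the type.  The list is sorted just to fix an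
   enumeration, which is immaterial because \<Phi> is permutation invariant. *)
definition log_eigenvalues :: "complex mat \<Rightarrow> complex mat \<Rightarrow> real vec" where
  "log_eigenvalues X Y = vec_of_list (sorted_list_of_multiset
     (image_mset (\<lambda>z. ln (Re z)) (eigenvalue_mset (the (mat_inverse X) * Y))))"

(* n is the dimension on which \<Phi> is a gauge; X and Y may be smaller. *)
definition delta_gauge ::
    "nat \<Rightarrow> (real vec \<Rightarrow> real) \<Rightarrow> complex mat \<Rightarrow> complex mat \<Rightarrow> real" where
  "delta_gauge n \<Phi> X Y = \<Phi> (zero_pad n (log_eigenvalues X Y))"

end

theory Submission
  imports Defs "Jordan_Normal_Form.Spectral_Radius"
begin

text \<open>
  A congruence diagonalises A and B simultaneously, turning A into the identity and B into the
  diagonal matrix of the eigenvalues of the pencil; the same applies to the compressions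
  \<open>P\<^sup>*AP\<close> and \<open>P\<^sup>*BP\<close>. A Courant--Fischer dimension count then shows that the increasingly
  ordered eigenvalues \<open>\<lambda>\<close> of the pencil and \<open>\<mu>\<close> of its compression interlace:
  \<open>\<lambda>\<^sub>i \<le> \<mu>\<^sub>i \<le> \<lambda>\<^sub>n\<^sub>-\<^sub>k\<^sub>+\<^sub>i\<close>. Hence \<open>\<bar>log \<mu>\<^sub>i\<bar>\<close> is at most \<open>\<bar>log \<lambda>\<^sub>i\<bar>\<close> if
  \<open>log \<mu>\<^sub>i < 0\<close> and at most \<open>\<bar>log \<lambda>\<^sub>n\<^sub>-\<^sub>k\<^sub>+\<^sub>i\<bar>\<close> otherwise. The indices chosen in this way are distinct, so
  the padded vector for the compressions is dominated entrywise, in absolute value, by a permutation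
  of the vector for A and B, and a symmetric gauge is monotone in the absolute values of the entries.
\<close>

section \<open>Symmetric gauge functions\<close>

lemma symmetric_gauge_update_le:
  assumes g: "symmetric_gauge n \<Phi>" and y: "y \<in> carrier_vec n" and i: "i < n"
    and s: "\<bar>s\<bar> \<le> \<bar>y $ i\<bar>"
  shows "\<Phi> (vec n (\<lambda>j. if j = i then s else y $ j)) \<le> \<Phi> y"
proof (cases "y $ i = 0")
  case True
  then have "vec n (\<lambda>j. if j = i then s else y $ j) = y"
    using s y by auto
  then show ?thesis by simp
next
  case False
  txt \<open>The updated vector is a convex combination of \<open>y\<close> and its reflection in coordinate \<open>i\<close>.\<close>
  define y' where "y' = vec n (\<lambda>j. if j = i then - y $ i else y $ j)"
  have N: "norm_on_vec n \<Phi>" using g by (simp add: symmetric_gauge_def)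
  have tri: "\<Phi> (x + z) \<le> \<Phi> x + \<Phi> z" if "x \<in> carrier_vec n" "z \<in> carrier_vec n" for x z
    using N that unfolding norm_on_vec_def by blast
  have hom: "\<Phi> (c \<cdot>\<^sub>v x) = \<bar>c\<bar> * \<Phi> x" if "x \<in> carrier_vec n" for c x
    using N that unfolding norm_on_vec_def by blast
  \<comment> \<open>The weights solve \<open>a + b = 1\<close> and \<open>a - b = t\<close>:
    coordinates other than \<open>i\<close> stay put, while coordinate \<open>i\<close> becomes
    \<open>t * y $ i\<close>, which is \<open>s\<close>. The bound on \<open>s\<close> makes both
    weights nonnegative.\<close>
  define t where "t = s / y $ i"
  define a where "a = (1 + t) / 2"
  define b where "b = (1 - t) / 2"
  have t: "\<bar>t\<bar> \<le> 1" using s False by (simp add: t_def abs_divide)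
  then have ab: "0 \<le> a" "0 \<le> b" "a + b = 1" by (auto simp: a_def b_def field_simps)
  have y': "y' \<in> carrier_vec n" by (simp add: y'_def)
  have "map_vec abs y' = map_vec abs y" using y by (auto simp: y'_def)
  then have eq: "\<Phi> y' = \<Phi> y" using g y y' unfolding symmetric_gauge_def by blast
  have "a * y $ i - b * y $ i = s" using False by (simp add: a_def b_def t_def field_simps)
  moreover have "a * z + b * z = z" for z using ab(3) by (metis distrib_right mult_1)
  ultimately have x: "vec n (\<lambda>j. if j = i then s else y $ j) = a \<cdot>\<^sub>v y + b \<cdot>\<^sub>v y'"
    using y by (auto simp: y'_def)
  have "\<Phi> (a \<cdot>\<^sub>v y + b \<cdot>\<^sub>v y') \<le> \<Phi> (a \<cdot>\<^sub>v y) + \<Phi> (b \<cdot>\<^sub>v y')"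
    by (rule tri) (use y y' in auto)
  also have "\<dots> = \<bar>a\<bar> * \<Phi> y + \<bar>b\<bar> * \<Phi> y'" using hom[OF y] hom[OF y'] by simp
  also have "\<dots> = \<Phi> y" using ab eq by (metis abs_of_nonneg distrib_right mult_1)
  finally show ?thesis unfolding x .
qed

text \<open>The entries of \<open>y\<close> are replaced by those of \<open>x\<close> one coordinate
  at a time, and no replacement increases the gauge. The induction counts the coordinates already
  replaced.\<close>

lemma symmetric_gauge_mono:
  assumes g: "symmetric_gauge n \<Phi>" and x: "x \<in> carrier_vec n" and y: "y \<in> carrier_vec n"
    and le: "\<And>i. i < n \<Longrightarrow> \<bar>x $ i\<bar> \<le> \<bar>y $ i\<bar>"
  shows "\<Phi> x \<le> \<Phi> y"
proof -
  have "\<Phi> (vec n (\<lambda>j. if j < m then x $ j else y $ j)) \<le> \<Phi> y" if "m \<le> n" for m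
    using that
  proof (induction m)
    case 0
    have "vec n (\<lambda>j. y $ j) = y" using y by auto
    then show ?case by simp
  next
    case (Suc m)
    let ?z = "vec n (\<lambda>j. if j < m then x $ j else y $ j)"
    have "vec n (\<lambda>j. if j < Suc m then x $ j else y $ j)
      = vec n (\<lambda>j. if j = m then x $ m else ?z $ j)"
      by (auto simp: less_Suc_eq)
    also have "\<Phi> \<dots> \<le> \<Phi> ?z"
      by (rule symmetric_gauge_update_le[OF g]) (use Suc.prems le in auto)
    also have "\<dots> \<le> \<Phi> y" using Suc by simp
    finally show ?case .
  qed
  from this[of n] have "\<Phi> (vec n (\<lambda>j. if j < n then x $ j else y $ j)) \<le> \<Phi> y" by simp
  also have "vec n (\<lambda>j. if j < n then x $ j else y $ j) = x" using x by auto
  finally show ?thesis .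
qed

text \<open>The domain of \<open>f\<close> and its image have complements of equal size in
  \<open>{..<n}\<close>, so \<open>f\<close> can be glued with any bijection between them. This
  turns a selection of \<open>k\<close> coordinates into a permutation, under which the gauge is
  invariant.\<close>

lemma inj_on_extends_to_permutation:
  fixes f :: "nat \<Rightarrow> nat"
  assumes inj: "inj_on f {..<k}" and f: "f ` {..<k} \<subseteq> {..<n}"
  obtains p where "p permutes {..<n}" "\<And>i. i < k \<Longrightarrow> p i = f i"
proof -
  have kn: "k \<le> n" using card_inj_on_le[OF inj f] by simp
  have "card ({..<n} - {..<k}) = card ({..<n} - f ` {..<k})"
    using f kn by (simp add: card_Diff_subset card_image[OF inj])
  then obtain h where h: "bij_betw h ({..<n} - {..<k}) ({..<n} - f ` {..<k})"
    by (metis finite_Diff finite_lessThan finite_same_card_bij)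
  define p where "p = (\<lambda>i. if i < k then f i else if i < n then h i else i)"
  have "bij_betw p {..<k} (f ` {..<k})"
    using inj by (subst bij_betw_cong[of _ _ f]) (auto simp: p_def bij_betw_def)
  moreover have "bij_betw p ({..<n} - {..<k}) ({..<n} - f ` {..<k})"
    using h by (subst bij_betw_cong[of _ _ h]) (auto simp: p_def)
  ultimately have "bij_betw p ({..<k} \<union> ({..<n} - {..<k})) (f ` {..<k} \<union> ({..<n} - f ` {..<k}))"
    by (rule bij_betw_combine) auto
  moreover have "{..<k} \<union> ({..<n} - {..<k}) = {..<n}" "f ` {..<k} \<union> ({..<n} - f ` {..<k}) = {..<n}"
    using kn f by auto
  ultimately have "bij_betw p {..<n} {..<n}" by simp
  then have "p permutes {..<n}"
    by (rule bij_imp_permutes) (use kn in \<open>auto simp: p_def\<close>)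
  then show thesis by (rule that) (simp add: p_def)
qed

text \<open>The padded entries are zero, hence dominated by anything. Only the \<open>k\<close>
  genuine entries constrain the permutation, and its remaining values may be arbitrary.\<close>

lemma symmetric_gauge_zero_pad_le:
  assumes g: "symmetric_gauge n \<Phi>" and v: "v \<in> carrier_vec k" and w: "w \<in> carrier_vec n"
    and inj: "inj_on f {..<k}" and f: "f ` {..<k} \<subseteq> {..<n}"
    and le: "\<And>i. i < k \<Longrightarrow> \<bar>v $ i\<bar> \<le> \<bar>w $ f i\<bar>"
  shows "\<Phi> (zero_pad n v) \<le> \<Phi> w"
proof -
  have kn: "k \<le> n" using card_inj_on_le[OF inj f] by simp
  obtain p where p: "p permutes {..<n}" "\<And>i. i < k \<Longrightarrow> p i = f i"
    by (rule inj_on_extends_to_permutation[OF inj f]) blast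
  have "\<Phi> (zero_pad n v) \<le> \<Phi> (vec n (\<lambda>i. w $ p i))"
  proof (rule symmetric_gauge_mono[OF g])
    show "zero_pad n v \<in> carrier_vec n" using v kn by (intro carrier_vecI) (simp add: zero_pad_def)
  qed (use v kn le p in \<open>auto simp: zero_pad_def\<close>)
  also have "\<dots> = \<Phi> w" using g p(1) w unfolding symmetric_gauge_def by blast
  finally show ?thesis .
qed

lemma zero_pad_id: "v \<in> carrier_vec n \<Longrightarrow> zero_pad n v = v"
  by (auto simp: zero_pad_def)

section \<open>Congruence and simultaneous diagonalization\<close>

lemma mat_adjoint_dim [simp]:
  "dim_row (mat_adjoint A) = dim_col A" "dim_col (mat_adjoint A) = dim_row A"
  by (simp_all add: mat_adjoint_def)

lemma mat_adjoint_carrier [simp]: "A \<in> carrier_mat n m \<Longrightarrow> mat_adjoint A \<in> carrier_mat m n"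
  by (intro carrier_matI) auto

lemma mat_adjoint_index [simp]:
  "i < dim_col A \<Longrightarrow> j < dim_row A \<Longrightarrow> mat_adjoint A $$ (i, j) = conjugate (A $$ (j, i))"
  by (simp add: mat_adjoint_def mat_of_rows_index)

lemma mat_adjoint_adjoint [simp]: "mat_adjoint (mat_adjoint A) = A"
  by (rule eq_matI) auto

lemma mat_adjoint_mult:
  fixes A B :: "'a :: conjugatable_field mat"
  assumes "A \<in> carrier_mat n m" and "B \<in> carrier_mat m k"
  shows "mat_adjoint (A * B) = mat_adjoint B * mat_adjoint A"
proof (rule eq_matI)
  fix i j assume "i < dim_row (mat_adjoint B * mat_adjoint A)"
    and "j < dim_col (mat_adjoint B * mat_adjoint A)"
  then have ij: "i < k" "j < n" using assms by auto
  have "conjugate (row A j \<bullet> col B i) = conjugate (row A j) \<bullet> conjugate (col B i)"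
    by (rule conjugate_sprod_vec[of _ m]) (use assms in auto)
  also have "\<dots> = conjugate (col B i) \<bullet> conjugate (row A j)"
    by (rule comm_scalar_prod[of _ m]) (use assms in auto)
  also have "conjugate (col B i) = row (mat_adjoint B) i"
    using ij assms by (auto simp: mat_adjoint_def)
  also have "conjugate (row A j) = col (mat_adjoint A) j"
    using ij assms by (intro eq_vecI) auto
  finally show "mat_adjoint (A * B) $$ (i, j) = (mat_adjoint B * mat_adjoint A) $$ (i, j)"
    using ij assms by simp
qed (use assms in auto)

lemma scalar_prod_mat_adjoint:
  fixes A :: "'a :: conjugatable_field mat"
  assumes A: "A \<in> carrier_mat n m" and x: "x \<in> carrier_vec m" and y: "y \<in> carrier_vec n"
  shows "(A *\<^sub>v x) \<bullet>c y = x \<bullet>c (mat_adjoint A *\<^sub>v y)"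
proof -
  have "(A *\<^sub>v x) \<bullet>c y = (\<Sum>i<n. \<Sum>j<m. A $$ (i, j) * x $ j * conjugate (y $ i))"
    using assms by (simp add: scalar_prod_def sum_distrib_right atLeast0LessThan)
  also have "\<dots> = (\<Sum>j<m. \<Sum>i<n. x $ j * (A $$ (i, j) * conjugate (y $ i)))"
    by (subst sum.swap) (simp add: mult_ac)
  also have "\<dots> = (\<Sum>j<m. x $ j * conjugate (\<Sum>i<n. conjugate (A $$ (i, j)) * y $ i))"
    by (simp add: sum_distrib_left sum_conjugate conjugate_dist_mul)
  also have "\<dots> = x \<bullet>c (mat_adjoint A *\<^sub>v y)"
    using assms by (simp add: scalar_prod_def atLeast0LessThan)
  finally show ?thesis .
qed

lemma hermitian_mat_swap:
  assumes "A \<in> carrier_mat n n" "hermitian_mat A" "x \<in> carrier_vec n" "y \<in> carrier_vec n"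
  shows "(A *\<^sub>v x) \<bullet>c y = cnj ((A *\<^sub>v y) \<bullet>c x)"
proof -
  have "(A *\<^sub>v x) \<bullet>c y = x \<bullet>c (A *\<^sub>v y)"
    using scalar_prod_mat_adjoint[of A n n x y] assms by (simp add: hermitian_mat_def)
  also have "\<dots> = conjugate ((A *\<^sub>v y) \<bullet>c x)"
    using assms by (subst conjugate_sprod_vec[of _ n]) (auto intro!: comm_scalar_prod)
  finally show ?thesis by simp
qed

lemma hermitian_mat_congruence:
  assumes "A \<in> carrier_mat n n" "hermitian_mat A" "W \<in> carrier_mat n m"
  shows "hermitian_mat (mat_adjoint W * A * W)"
proof -
  have W: "mat_adjoint W \<in> carrier_mat m n" using assms by simp
  have "mat_adjoint (mat_adjoint W * A * W) = mat_adjoint W * mat_adjoint (mat_adjoint W * A)"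
    by (rule mat_adjoint_mult) (use mult_carrier_mat[OF W assms(1)] assms in auto)
  also have "mat_adjoint (mat_adjoint W * A) = A * W"
    using mat_adjoint_mult[OF W assms(1)] assms(2) by (simp add: hermitian_mat_def)
  also have "mat_adjoint W * (A * W) = mat_adjoint W * A * W"
    using assoc_mult_mat[OF W assms(1,3)] by simp
  finally show ?thesis by (simp add: hermitian_mat_def)
qed

lemma congruence_scalar_prod:
  fixes A :: "complex mat"
  assumes "A \<in> carrier_mat n n" "W \<in> carrier_mat n m" "x \<in> carrier_vec m" "y \<in> carrier_vec m"
  shows "((mat_adjoint W * A * W) *\<^sub>v x) \<bullet>c y = (A *\<^sub>v (W *\<^sub>v x)) \<bullet>c (W *\<^sub>v y)"
proof -
  have "(mat_adjoint W * A * W) *\<^sub>v x = mat_adjoint W *\<^sub>v (A *\<^sub>v (W *\<^sub>v x))"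
    using assms assoc_mult_mat_vec[of "mat_adjoint W * A" m n W m x]
      assoc_mult_mat_vec[of "mat_adjoint W" m n A n "W *\<^sub>v x"]
      mult_carrier_mat[of "mat_adjoint W" m n A n] by simp
  also have "\<dots> \<bullet>c y = (A *\<^sub>v (W *\<^sub>v x)) \<bullet>c (W *\<^sub>v y)"
    using assms by (subst scalar_prod_mat_adjoint[of _ m n]) auto
  finally show ?thesis .
qed

text \<open>Injectivity keeps \<open>W *\<^sub>v x\<close> nonzero, so positivity is inherited from
  \<open>A\<close>. It serves both for the compression by \<open>P\<close> and for restricting a
  form to an orthogonal complement.\<close>

lemma positive_definite_mat_congruence:
  assumes A: "positive_definite_mat n A" and W: "W \<in> carrier_mat n m"
    and inj: "\<And>x. x \<in> carrier_vec m \<Longrightarrow> W *\<^sub>v x = 0\<^sub>v n \<Longrightarrow> x = 0\<^sub>v m"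
  shows "positive_definite_mat m (mat_adjoint W * A * W)"
  unfolding positive_definite_mat_def
proof (intro conjI ballI impI)
  have A': "A \<in> carrier_mat n n" "hermitian_mat A" using A by (auto simp: positive_definite_mat_def)
  show "mat_adjoint W * A * W \<in> carrier_mat m m" using A' W by (meson mat_adjoint_carrier mult_carrier_mat)
  show "hermitian_mat (mat_adjoint W * A * W)" by (rule hermitian_mat_congruence[OF A' W])
  fix x :: "complex vec" assume x: "x \<in> carrier_vec m" "x \<noteq> 0\<^sub>v m"
  then have "W *\<^sub>v x \<noteq> 0\<^sub>v n" using inj by blast
  then show "0 < Re (((mat_adjoint W * A * W) *\<^sub>v x) \<bullet>c x)"
    using A W x(1) by (simp add: congruence_scalar_prod[OF A'(1) W] positive_definite_mat_def)
qed

text \<open>The distance is defined through the option value \<open>mat_inverse\<close>; uniqueness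
  of inverses identifies that value with an explicitly known inverse.\<close>

lemma mat_inverse_eqI:
  fixes A :: "'a :: field mat"
  assumes A: "A \<in> carrier_mat n n" and C: "C \<in> carrier_mat n n" and AC: "A * C = 1\<^sub>m n"
  shows "mat_inverse A = Some C"
proof -
  have CA: "C * A = 1\<^sub>m n" by (rule mat_mult_left_right_inverse[OF A C AC])
  have "A \<in> Units (ring_mat TYPE('a) n ())"
    using A C AC CA by (auto simp: Units_def ring_mat_def)
  then obtain D where D: "mat_inverse A = Some D"
    using mat_inverse(1)[OF A, where b = "()"] by (cases "mat_inverse A") auto
  from mat_inverse(2)[OF A D] have D': "D * A = 1\<^sub>m n" "D \<in> carrier_mat n n" by auto
  have "D = D * (A * C)" using D' by (simp add: AC)
  also have "\<dots> = C" using D' A C by (simp flip: assoc_mult_mat[of D n n A n C n])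
  finally show ?thesis using D by simp
qed

section \<open>Simultaneous diagonalization of a definite pencil\<close>

lemma positive_definite_mat_scalar_prod_self:
  assumes A: "positive_definite_mat n A" and v: "v \<in> carrier_vec n" "v \<noteq> 0\<^sub>v n"
  obtains r where "(A *\<^sub>v v) \<bullet>c v = of_real r" "r > 0"
proof -
  have "(A *\<^sub>v v) \<bullet>c v = cnj ((A *\<^sub>v v) \<bullet>c v)"
    using A v by (intro hermitian_mat_swap) (auto simp: positive_definite_mat_def)
  then have "(A *\<^sub>v v) \<bullet>c v = of_real (Re ((A *\<^sub>v v) \<bullet>c v))"
    by (metis Reals_cnj_iff of_real_Re)
  moreover have "Re ((A *\<^sub>v v) \<bullet>c v) > 0" using A v by (simp add: positive_definite_mat_def)
  ultimately show thesis by (rule that)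
qed

text \<open>An eigenvector \<open>w\<close> of the inverse of \<open>A\<close> times
  \<open>B\<close> exists over the complex numbers and satisfies \<open>B w = z A w\<close>. Pairing
  with \<open>w\<close> expresses \<open>z\<close> as a quotient of two real form values with
  positive denominator, so \<open>z\<close> is real.\<close>

lemma hermitian_pencil_eigenvector:
  assumes A: "positive_definite_mat n A" and B: "B \<in> carrier_mat n n" "hermitian_mat B"
    and n: "n > 0"
  obtains v d where "v \<in> carrier_vec n" "(A *\<^sub>v v) \<bullet>c v = 1" "B *\<^sub>v v = of_real d \<cdot>\<^sub>v (A *\<^sub>v v)"
proof -
  have A': "A \<in> carrier_mat n n" using A by (simp add: positive_definite_mat_def)
  have "det A \<noteq> 0"
  proof
    assume "det A = 0"
    then obtain x where "x \<in> carrier_vec n" "x \<noteq> 0\<^sub>v n" "A *\<^sub>v x = 0\<^sub>v n"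
      using det_0_iff_vec_prod_zero[OF A'] by blast
    moreover from this obtain r where "(A *\<^sub>v x) \<bullet>c x = of_real r" "r > 0"
      using positive_definite_mat_scalar_prod_self[OF A] by blast
    ultimately show False by simp
  qed
  then have "A \<in> Units (ring_mat TYPE(complex) n ())" by (rule det_non_zero_imp_unit[OF A'])
  then obtain C where AC: "A * C = 1\<^sub>m n" "C \<in> carrier_mat n n"
    by (auto simp: Units_def ring_mat_def)
  have CB: "C * B \<in> carrier_mat n n" using AC B by simp
  obtain z w where "eigenvector (C * B) w z"
    using spectrum_non_empty[OF CB n] by (auto simp: spectrum_def eigenvalue_def)
  then have w: "w \<in> carrier_vec n" "w \<noteq> 0\<^sub>v n" "(C * B) *\<^sub>v w = z \<cdot>\<^sub>v w"
    using CB by (auto simp: eigenvector_def)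
  have "B *\<^sub>v w = (A * C) *\<^sub>v (B *\<^sub>v w)" using B w by (simp add: AC)
  also have "\<dots> = A *\<^sub>v ((C * B) *\<^sub>v w)"
    using AC(2) A' B w by (simp add: assoc_mult_mat_vec[of _ n n _ n])
  also have "\<dots> = z \<cdot>\<^sub>v (A *\<^sub>v w)" using A' w by (simp add: mult_mat_vec)
  finally have Bw: "B *\<^sub>v w = z \<cdot>\<^sub>v (A *\<^sub>v w)" .
  obtain r where r: "(A *\<^sub>v w) \<bullet>c w = of_real r" "r > 0"
    using positive_definite_mat_scalar_prod_self[OF A w(1,2)] .
  have "z * of_real r = (B *\<^sub>v w) \<bullet>c w" using A' w r by (simp add: Bw)
  moreover have "(B *\<^sub>v w) \<bullet>c w = cnj ((B *\<^sub>v w) \<bullet>c w)" by (rule hermitian_mat_swap[OF B w(1) w(1)])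
  ultimately have "cnj z = z" using r(2) by (metis complex_cnj_complex_of_real complex_cnj_mult
    mult_cancel_right of_real_eq_0_iff less_irrefl)
  then have z: "z = of_real (Re z)" by (metis Reals_cnj_iff of_real_Re)
  \<comment> \<open>Rescaling by this factor changes the value \<open>r\<close> of the form of
    \<open>A\<close> at \<open>w\<close> into 1.\<close>
  define s where "s = complex_of_real (1 / sqrt r)"
  have s: "s * cnj s * of_real r = 1" using r(2)
    by (simp add: s_def flip: of_real_mult of_real_divide)
  show thesis
  proof (rule that)
    show "s \<cdot>\<^sub>v w \<in> carrier_vec n" using w by simp
    show "(A *\<^sub>v (s \<cdot>\<^sub>v w)) \<bullet>c (s \<cdot>\<^sub>v w) = 1"
      using A' w s r by (simp add: mult_mat_vec[of A n n] conjugate_smult_vec mult_ac)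
    show "B *\<^sub>v (s \<cdot>\<^sub>v w) = of_real (Re z) \<cdot>\<^sub>v (A *\<^sub>v (s \<cdot>\<^sub>v w))"
      using A' B w z by (simp add: mult_mat_vec[of _ n n] Bw smult_smult_assoc mult_ac)
  qed
qed

text \<open>An explicit basis of the complement: with a pivot \<open>p\<close> where
  \<open>u\<close> is nonzero, column \<open>j\<close> has 1 at the \<open>j\<close>-th index other
  than \<open>p\<close> and the correction at \<open>p\<close> that makes it orthogonal to
  \<open>u\<close>. The rows other than \<open>p\<close> form an identity matrix, whence
  injectivity.\<close>

lemma orthogonal_complement_mat:
  fixes u :: "complex vec"
  assumes u: "u \<in> carrier_vec (Suc m)" "u \<noteq> 0\<^sub>v (Suc m)"
  obtains Q where "Q \<in> carrier_mat (Suc m) m"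
    "\<And>x. x \<in> carrier_vec m \<Longrightarrow> u \<bullet>c (Q *\<^sub>v x) = 0"
    "\<And>x. x \<in> carrier_vec m \<Longrightarrow> Q *\<^sub>v x = 0\<^sub>v (Suc m) \<Longrightarrow> x = 0\<^sub>v m"
proof -
  obtain p where p: "p < Suc m" "u $ p \<noteq> 0"
    using u by (metis carrier_vecD eq_vecI index_zero_vec)
  define c where "c j = u $ insert_index p j / u $ p" for j
  define Q where "Q = mat (Suc m) m
    (\<lambda>(i, j). if i = p then - cnj (c j) else if i = insert_index p j then 1 else 0)"
  have Q: "Q \<in> carrier_mat (Suc m) m" by (simp add: Q_def)
  have ins: "insert_index p j < Suc m" if "j < m" for j
    using that p by (auto simp: insert_index_def)
  have "mat_adjoint Q *\<^sub>v u = 0\<^sub>v m"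
  proof (rule eq_vecI)
    fix j assume "j < dim_vec (0\<^sub>v m :: complex vec)"
    then have j: "j < m" by simp
    have "(mat_adjoint Q *\<^sub>v u) $ j = (\<Sum>i<Suc m. cnj (Q $$ (i, j)) * u $ i)"
      using j Q u by (simp add: scalar_prod_def atLeast0LessThan del: sum.lessThan_Suc)
    also have "\<dots> = (\<Sum>i<Suc m. (if i = p then - c j * u $ i else 0)
        + (if i = insert_index p j then u $ i else 0))"
      using j by (intro sum.cong) (auto simp: Q_def)
    also have "\<dots> = - c j * u $ p + u $ insert_index p j"
      using p(1) ins[OF j] by (simp add: sum.distrib del: sum.lessThan_Suc)
    also have "\<dots> = 0" using p(2) by (simp add: c_def)
    finally show "(mat_adjoint Q *\<^sub>v u) $ j = 0\<^sub>v m $ j" using j by simp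
  qed (use Q in auto)
  then have orth: "u \<bullet>c (Q *\<^sub>v x) = 0" if "x \<in> carrier_vec m" for x
    using scalar_prod_mat_adjoint[of "mat_adjoint Q" m "Suc m" u x] Q u that by simp
  have inj: "x = 0\<^sub>v m" if x: "x \<in> carrier_vec m" "Q *\<^sub>v x = 0\<^sub>v (Suc m)" for x
  proof (rule eq_vecI)
    fix j assume "j < dim_vec (0\<^sub>v m :: complex vec)"
    then have j: "j < m" by simp
    have "0 = (Q *\<^sub>v x) $ insert_index p j" using ins[OF j] x by simp
    also have "\<dots> = (\<Sum>l<m. Q $$ (insert_index p j, l) * x $ l)"
      using ins[OF j] x(1) Q by (simp add: scalar_prod_def atLeast0LessThan)
    also have "\<dots> = (\<Sum>l<m. if l = j then x $ l else 0)"
      using ins[OF j] by (intro sum.cong) (auto simp: Q_def inj_eq[OF insert_index_inj_on])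
    also have "\<dots> = x $ j" using j by simp
    finally show "x $ j = 0\<^sub>v m $ j" using j by simp
  qed (use x in auto)
  show thesis
    by (rule that[OF Q]) (fact orth, fact inj)
qed

text \<open>Independence is a property of the set of columns, so repeated columns must be excluded
  first. A maximal independent subset of that set has \<open>k\<close> elements, which forces the
  \<open>k\<close> columns to be distinct; a nonzero kernel vector would then be a
  dependency.\<close>

lemma (in vec_space) full_rank_mult_mat_vec_inj:
  assumes P: "P \<in> carrier_mat n k" and rank: "rank P = k"
    and x: "x \<in> carrier_vec k" "P *\<^sub>v x = 0\<^sub>v n"
  shows "x = 0\<^sub>v k"
proof (rule ccontr)
  assume "x \<noteq> 0\<^sub>v k"
  obtain S where S: "maximal S (\<lambda>T. T \<subseteq> set (cols P) \<and> lin_indpt T)"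
    using maximal_exists[of "(\<lambda>T. T \<subseteq> set (cols P) \<and> lin_indpt T)" "card (set (cols P))" "{}"]
    by (meson List.finite_set card_mono empty_iff empty_subsetI finite_lin_indpt2 rev_finite_subset)
  then have "card S \<le> card (set (cols P))" by (simp add: card_mono maximal_def)
  then have "k \<le> card (set (cols P))" using rank_card_indpt[OF P S] rank by simp
  moreover have "length (cols P) = k" using P by simp
  ultimately have dist: "distinct (cols P)" by (metis card_distinct card_length le_antisym)
  show False
    using lin_depI[OF P x(1) \<open>x \<noteq> 0\<^sub>v k\<close> x(2) dist] full_rank_lin_indpt[OF P rank dist] by simp
qed

text \<open>Deflation: split off a normalized eigenvector \<open>v\<close> of the pencil and
  restrict both forms to the complement of \<open>A *\<^sub>v v\<close>. Since
  \<open>B *\<^sub>v v\<close> is a multiple of \<open>A *\<^sub>v v\<close>, that complement is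
  orthogonal to \<open>v\<close> for both forms. The columns of \<open>Q\<close> are coordinates on
  it, and the restricted form of \<open>A\<close> is again positive definite.\<close>

lemma simultaneous_diagonalization_vectors:
  assumes "positive_definite_mat n A" and "B \<in> carrier_mat n n" "hermitian_mat B"
  shows "\<exists>u (d :: nat \<Rightarrow> real). (\<forall>i<n. u i \<in> carrier_vec n) \<and>
    (\<forall>i<n. \<forall>j<n. (A *\<^sub>v u j) \<bullet>c u i = (if i = j then 1 else 0) \<and>
       (B *\<^sub>v u j) \<bullet>c u i = (if i = j then of_real (d i) else 0))"
  using assms
proof (induction n arbitrary: A B)
  case 0
  then show ?case by simp
next
  case (Suc m)
  let ?n = "Suc m"
  have A: "A \<in> carrier_mat ?n ?n" "hermitian_mat A"
    using Suc.prems(1) by (auto simp: positive_definite_mat_def)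
  note B = Suc.prems(2,3)
  obtain v d where v: "v \<in> carrier_vec ?n" "(A *\<^sub>v v) \<bullet>c v = 1"
    "B *\<^sub>v v = of_real d \<cdot>\<^sub>v (A *\<^sub>v v)"
    using hermitian_pencil_eigenvector[OF Suc.prems] by auto
  have Av: "A *\<^sub>v v \<in> carrier_vec ?n" "A *\<^sub>v v \<noteq> 0\<^sub>v ?n" using A v by auto
  obtain Q where Q: "Q \<in> carrier_mat ?n m"
    and orth: "\<And>x. x \<in> carrier_vec m \<Longrightarrow> (A *\<^sub>v v) \<bullet>c (Q *\<^sub>v x) = 0"
    and inj: "\<And>x. x \<in> carrier_vec m \<Longrightarrow> Q *\<^sub>v x = 0\<^sub>v ?n \<Longrightarrow> x = 0\<^sub>v m"
    using orthogonal_complement_mat[OF Av] by blast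
  have pd: "positive_definite_mat m (mat_adjoint Q * A * Q)"
    using positive_definite_mat_congruence[OF Suc.prems(1) Q] inj by blast
  have "mat_adjoint Q * B * Q \<in> carrier_mat m m" using B Q by (meson mat_adjoint_carrier mult_carrier_mat)
  from Suc.IH[OF pd this hermitian_mat_congruence[OF B Q]]
  obtain u e where u: "\<And>i. i < m \<Longrightarrow> u i \<in> carrier_vec m"
    and ue: "\<And>i j. i < m \<Longrightarrow> j < m \<Longrightarrow>
       ((mat_adjoint Q * A * Q) *\<^sub>v u j) \<bullet>c u i = (if i = j then 1 else 0) \<and>
       ((mat_adjoint Q * B * Q) *\<^sub>v u j) \<bullet>c u i = (if i = j then of_real (e i) else (0 :: complex))"
    by blast
  have AQ: "(A *\<^sub>v (Q *\<^sub>v u j)) \<bullet>c (Q *\<^sub>v u i) = (if i = j then 1 else 0)"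
    and BQ: "(B *\<^sub>v (Q *\<^sub>v u j)) \<bullet>c (Q *\<^sub>v u i) = (if i = j then of_real (e i) else 0)"
    if "i < m" "j < m" for i j
    using ue[OF that] congruence_scalar_prod[OF A(1) Q u[OF that(2)] u[OF that(1)]]
      congruence_scalar_prod[OF B(1) Q u[OF that(2)] u[OF that(1)]] by simp_all
  have Qu: "Q *\<^sub>v u i \<in> carrier_vec ?n" if "i < m" for i using Q u[OF that] by simp
  have vQ: "(A *\<^sub>v v) \<bullet>c (Q *\<^sub>v u i) = 0" "(B *\<^sub>v v) \<bullet>c (Q *\<^sub>v u i) = 0" if "i < m" for i
    using orth[OF u[OF that]] Av Qu[OF that] by (simp_all add: v(3))
  have Qv: "(A *\<^sub>v (Q *\<^sub>v u i)) \<bullet>c v = 0" "(B *\<^sub>v (Q *\<^sub>v u i)) \<bullet>c v = 0" if "i < m" for i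
    using vQ[OF that] hermitian_mat_swap[OF A Qu[OF that] v(1)]
      hermitian_mat_swap[OF B Qu[OF that] v(1)] by simp_all
  have vv: "(B *\<^sub>v v) \<bullet>c v = of_real d" using Av v by simp
  define u' where "u' i = (case i of 0 \<Rightarrow> v | Suc i \<Rightarrow> Q *\<^sub>v u i)" for i
  define d' where "d' i = (case i of 0 \<Rightarrow> d | Suc i \<Rightarrow> e i)" for i
  have "\<forall>i<?n. u' i \<in> carrier_vec ?n"
    using v(1) Qu by (auto simp: u'_def split: nat.split)
  moreover have "\<forall>i<?n. \<forall>j<?n. (A *\<^sub>v u' j) \<bullet>c u' i = (if i = j then 1 else 0) \<and>
       (B *\<^sub>v u' j) \<bullet>c u' i = (if i = j then of_real (d' i) else 0)"
    using v(2) vv vQ Qv AQ BQ by (auto simp: u'_def d'_def split: nat.split)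
  ultimately show ?case by blast
qed

lemma simultaneous_diagonalization:
  assumes A: "positive_definite_mat n A" and B: "B \<in> carrier_mat n n" "hermitian_mat B"
  obtains S and d :: "nat \<Rightarrow> real" where "S \<in> carrier_mat n n"
    "mat_adjoint S * A * S = 1\<^sub>m n" "mat_adjoint S * B * S = mat_diag n (\<lambda>i. of_real (d i))"
proof -
  obtain u and d :: "nat \<Rightarrow> real" where u: "\<And>i. i < n \<Longrightarrow> u i \<in> carrier_vec n"
    and ud: "\<And>i j. i < n \<Longrightarrow> j < n \<Longrightarrow> (A *\<^sub>v u j) \<bullet>c u i = (if i = j then 1 else 0) \<and>
       (B *\<^sub>v u j) \<bullet>c u i = (if i = j then of_real (d i) else 0)"
    using simultaneous_diagonalization_vectors[OF assms] by blast
  define S where "S = mat n n (\<lambda>(i, j). u j $ i)"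
  have S: "S \<in> carrier_mat n n" by (simp add: S_def)
  have col: "col S j = u j" if "j < n" for j
    using u[OF that] that by (intro eq_vecI) (auto simp: S_def)
  \<comment> \<open>With the vectors \<open>u j\<close> as columns of \<open>S\<close>, the entries
    of the congruent matrix are the pairwise form values already computed in
    \<open>ud\<close>.\<close>
  have ent: "(mat_adjoint S * C * S) $$ (i, j) = (C *\<^sub>v u j) \<bullet>c u i"
    if C: "C \<in> carrier_mat n n" and ij: "i < n" "j < n" for C i j
  proof -
    have "mat_adjoint S * C * S = mat_adjoint S * (C * S)"
      by (rule assoc_mult_mat[of _ n n _ n _ n]) (use C S in auto)
    also have "\<dots> $$ (i, j) = row (mat_adjoint S) i \<bullet> col (C * S) j" using S C ij by simp
    also have "row (mat_adjoint S) i = conjugate (u i)"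
      using S ij by (subst col[symmetric]) (auto intro!: eq_vecI)
    also have "col (C * S) j = C *\<^sub>v u j" using col_mult2[OF C S ij(2)] ij col by simp
    also have "conjugate (u i) \<bullet> (C *\<^sub>v u j) = (C *\<^sub>v u j) \<bullet>c u i"
      using u C ij by (intro comm_scalar_prod[of _ n]) auto
    finally show ?thesis .
  qed
  have A': "A \<in> carrier_mat n n" using A by (simp add: positive_definite_mat_def)
  show thesis
  proof (rule that[OF S])
    show "mat_adjoint S * A * S = 1\<^sub>m n"
      by (rule eq_matI) (use S A' ud in \<open>auto simp: ent simp del: index_mult_mat(1)\<close>)
    show "mat_adjoint S * B * S = mat_diag n (\<lambda>i. of_real (d i))"
      by (rule eq_matI) (use S B ud in \<open>auto simp: ent mat_diag_def simp del: index_mult_mat(1)\<close>)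
  qed
qed

section \<open>Pencil eigenvalues read off from a diagonalizing congruence\<close>

lemma congruence_diag_scalar_prod:
  fixes C :: "complex mat"
  assumes C: "C \<in> carrier_mat n n" and S: "S \<in> carrier_mat n n"
    and diag: "mat_adjoint S * C * S = mat_diag n (\<lambda>i. of_real (d i))"
    and y: "y \<in> carrier_vec n"
  shows "(C *\<^sub>v (S *\<^sub>v y)) \<bullet>c (S *\<^sub>v y) = of_real (\<Sum>j<n. d j * (cmod (y $ j))\<^sup>2)"
proof -
  have "(C *\<^sub>v (S *\<^sub>v y)) \<bullet>c (S *\<^sub>v y) = (mat_diag n (\<lambda>i. of_real (d i)) *\<^sub>v y) \<bullet>c y"
    using congruence_scalar_prod[OF C S y y] diag by simp
  also have "\<dots> = (\<Sum>i<n. (mat_diag n (\<lambda>i. of_real (d i)) *\<^sub>v y) $ i * cnj (y $ i))"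
    using y by (simp add: scalar_prod_def atLeast0LessThan)
  also have "\<dots> = (\<Sum>i<n. of_real (d i) * y $ i * cnj (y $ i))"
  proof (rule sum.cong)
    fix i assume "i \<in> {..<n}"
    then have i: "i < n" by simp
    then have "(mat_diag n (\<lambda>i. of_real (d i)) *\<^sub>v y) $ i
      = (\<Sum>j<n. (if i = j then of_real (d j) else 0) * y $ j)"
      using y by (simp add: mat_diag_def scalar_prod_def atLeast0LessThan)
    also have "\<dots> = (\<Sum>j<n. if j = i then of_real (d j) * y $ j else 0)"
      by (intro sum.cong) auto
    also have "\<dots> = of_real (d i) * y $ i" using i by simp
    finally show "(mat_diag n (\<lambda>i. of_real (d i)) *\<^sub>v y) $ i * cnj (y $ i)
      = of_real (d i) * y $ i * cnj (y $ i)" by simp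
  qed simp
  also have "\<dots> = of_real (\<Sum>j<n. d j * (cmod (y $ j))\<^sup>2)"
    by (simp add: mult.assoc flip: complex_norm_square)
  finally show ?thesis .
qed

text \<open>The hypothesis says that \<open>mat_adjoint S * A\<close> is a left inverse of the
  square matrix \<open>S\<close>, hence also a right inverse. Reassociating the resulting product
  exhibits \<open>S * mat_adjoint S\<close> as the inverse of \<open>A\<close>.\<close>

lemma congruence_one_inverse:
  assumes A: "A \<in> carrier_mat n n" and S: "S \<in> carrier_mat n n"
    and one: "mat_adjoint S * A * S = 1\<^sub>m n"
  shows "S * (mat_adjoint S * A) = 1\<^sub>m n" and "mat_inverse A = Some (S * mat_adjoint S)"
proof -
  have S': "mat_adjoint S \<in> carrier_mat n n" and SA: "mat_adjoint S * A \<in> carrier_mat n n"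
    using A S by (auto intro: mult_carrier_mat)
  show *: "S * (mat_adjoint S * A) = 1\<^sub>m n" by (rule mat_mult_left_right_inverse[OF SA S one])
  have SS: "S * mat_adjoint S \<in> carrier_mat n n" using S S' by (rule mult_carrier_mat)
  have "A * (S * mat_adjoint S) = 1\<^sub>m n"
    by (rule mat_mult_left_right_inverse[OF SS A]) (use * assoc_mult_mat[OF S S' A] in simp)
  then show "mat_inverse A = Some (S * mat_adjoint S)" by (rule mat_inverse_eqI[OF A SS])
qed

text \<open>The inverse of \<open>A\<close> is \<open>S * mat_adjoint S\<close>, and
  \<open>mat_adjoint S * A\<close> is the inverse of \<open>S\<close>. So the inverse of
  \<open>A\<close> times \<open>B\<close> is similar, via \<open>S\<close>, to the diagonal matrix,
  and the roots of the characteristic polynomial are its entries with multiplicity.\<close>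

lemma eigenvalue_mset_pencil:
  assumes A: "A \<in> carrier_mat n n" and B: "B \<in> carrier_mat n n" and S: "S \<in> carrier_mat n n"
    and one: "mat_adjoint S * A * S = 1\<^sub>m n" and diag: "mat_adjoint S * B * S = mat_diag n d"
  shows "eigenvalue_mset (the (mat_inverse A) * B) = mset (map d [0..<n])"
proof -
  let ?T = "mat_adjoint S" and ?D = "mat_diag n d"
  note inv = congruence_one_inverse[OF A S one]
  have T: "?T \<in> carrier_mat n n" using S by simp
  note [simp] = mult_carrier_mat[of _ n n _ n] assoc_mult_mat[of _ n n _ n _ n]
  have "S * ?D * (?T * A) = S * (?T * B * S) * (?T * A)" by (simp add: diag)
  also have "\<dots> = S * ?T * B * (S * (?T * A))" using A B S T by simp
  also have "\<dots> = S * ?T * B" using A B S T by (simp add: inv(1))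
  finally have eq: "S * ?T * B = S * ?D * (?T * A)" by simp
  have "similar_mat_wit (S * ?T * B) ?D S (?T * A)"
    by (rule similar_mat_witI[OF inv(1) one eq]) (use A B S T in auto)
  then have "char_poly (S * ?T * B) = char_poly ?D"
    by (intro char_poly_similar) (auto simp: similar_mat_def)
  also have "\<dots> = (\<Prod>a\<leftarrow>diag_mat ?D. [:- a, 1:])"
    by (rule char_poly_upper_triangular[of _ n]) (auto simp: mat_diag_def)
  also have "diag_mat ?D = map d [0..<n]" by (auto simp: diag_mat_def mat_diag_def)
  finally have "char_poly (the (mat_inverse A) * B) = (\<Prod>a\<leftarrow>map d [0..<n]. [:- a, 1:])"
    by (simp add: inv(2))
  moreover have "proots (\<Prod>a\<leftarrow>as. [:- a, 1:]) = mset as" for as :: "complex list"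
  proof (induction as)
    case (Cons a as)
    have "(\<Prod>a\<leftarrow>as. [:- a, 1:]) \<noteq> 0" by (auto simp: prod_list_zero_iff)
    then have "proots ([:- a, 1:] * (\<Prod>a\<leftarrow>as. [:- a, 1:])) = proots [:- a, 1:] + mset as"
      using Cons.IH by (subst proots_mult) auto
    then show ?case by simp
  qed simp
  ultimately show ?thesis by (simp only: eigenvalue_mset_def)
qed

lemma log_eigenvalues_pencil:
  assumes "A \<in> carrier_mat n n" "B \<in> carrier_mat n n" "S \<in> carrier_mat n n"
    and "mat_adjoint S * A * S = 1\<^sub>m n"
    and "mat_adjoint S * B * S = mat_diag n (\<lambda>i. of_real (d i))"
  shows "log_eigenvalues A B = vec_of_list (sort (map (\<lambda>i. ln (d i)) [0..<n]))"
proof -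
  have "image_mset (\<lambda>z. ln (Re z)) (eigenvalue_mset (the (mat_inverse A) * B))
    = mset (map (\<lambda>i. ln (d i)) [0..<n])"
    unfolding eigenvalue_mset_pencil[OF assms] by (simp add: multiset.map_comp o_def)
  then show ?thesis by (simp add: log_eigenvalues_def del: mset_map)
qed

text \<open>\<open>d i\<close> is the value of the form of \<open>B\<close> at column
  \<open>i\<close> of \<open>S\<close>, a nonzero vector because the form of \<open>A\<close> equals
  1 there. Positivity allows inequalities between eigenvalues to pass to their logarithms.\<close>

lemma pencil_eigenvalue_pos:
  assumes A: "A \<in> carrier_mat n n" and B: "positive_definite_mat n B" and S: "S \<in> carrier_mat n n"
    and one: "mat_adjoint S * A * S = 1\<^sub>m n"
    and diag: "mat_adjoint S * B * S = mat_diag n (\<lambda>i. of_real (d i))" and i: "i < n"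
  shows "d i > 0"
proof -
  let ?x = "S *\<^sub>v unit_vec n i"
  have sum: "(\<Sum>j<n. f j * (cmod (unit_vec n i $ j))\<^sup>2) = f i" for f
  proof -
    have "(\<Sum>j<n. f j * (cmod (unit_vec n i $ j))\<^sup>2) = (\<Sum>j<n. if j = i then f j else 0)"
      using i by (intro sum.cong) auto
    then show ?thesis using i by simp
  qed
  have B': "B \<in> carrier_mat n n" using B by (simp add: positive_definite_mat_def)
  have "mat_adjoint S * A * S = mat_diag n (\<lambda>i. of_real 1)" using one by simp
  from congruence_diag_scalar_prod[OF A S this, of "unit_vec n i"]
  have "(A *\<^sub>v ?x) \<bullet>c ?x = 1" unfolding sum by simp
  then have "?x \<noteq> 0\<^sub>v n" using A by auto
  moreover have "?x \<in> carrier_vec n" using S by simp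
  ultimately have "0 < Re ((B *\<^sub>v ?x) \<bullet>c ?x)" using B by (simp add: positive_definite_mat_def)
  also have "(B *\<^sub>v ?x) \<bullet>c ?x = of_real (d i)"
    using congruence_diag_scalar_prod[OF B' S diag, of "unit_vec n i"] sum[of d] by simp
  finally show ?thesis by simp
qed

section \<open>Interlacing of eigenvalues under compression\<close>

lemma exists_vec_supported_annihilated:
  fixes G :: "'a :: field mat"
  assumes G: "G \<in> carrier_mat n k" and I: "I \<subseteq> {..<k}" and J: "J \<subseteq> {..<n}"
    and card: "card J < card I"
  obtains c where "c \<in> carrier_vec k" "c \<noteq> 0\<^sub>v k" "\<And>l. l < k \<Longrightarrow> l \<notin> I \<Longrightarrow> c $ l = 0"
    "\<And>j. j \<in> J \<Longrightarrow> (G *\<^sub>v c) $ j = 0"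
proof -
  have fin: "finite I" "finite J" using I J finite_subset by blast+
  \<comment> \<open>Each condition on \<open>c\<close> is orthogonality to a vector: a unit vector
    for an index outside \<open>I\<close>, a row of \<open>G\<close> for an index in
    \<open>J\<close>. Their number, \<open>k - card I + card J\<close>, is below
    \<open>k\<close>.\<close>
  define vs where "vs = map (unit_vec k) (sorted_list_of_set ({..<k} - I))
    @ map (row G) (sorted_list_of_set J)"
  have len: "length vs < k"
    using card card_mono[OF _ I] fin by (simp add: vs_def card_Diff_subset I)
  have vs: "set vs \<subseteq> carrier_vec k" using G by (auto simp: vs_def)
  txt \<open>At most \<open>k - 1\<close> linear conditions are imposed on \<open>c\<close>, so the square matrix of conditions has a
    zero row to spare and is singular.\<close>
  define M where "M = mat\<^sub>r k k (\<lambda>i. if i = k - 1 then 0\<^sub>v k else if i < length vs then vs ! i else 0\<^sub>v k)"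
  have M: "M \<in> carrier_mat k k" by (simp add: M_def)
  have "det M = 0" unfolding M_def
    by (rule det_row_0) (use len subsetD[OF vs nth_mem] in auto)
  then obtain c where c: "c \<in> carrier_vec k" "c \<noteq> 0\<^sub>v k" "M *\<^sub>v c = 0\<^sub>v k"
    using det_0_iff_vec_prod_zero[OF M] by blast
  have ann: "v \<bullet> c = 0" if v: "v \<in> set vs" for v
  proof -
    obtain t where t: "t < length vs" "v = vs ! t" using v by (metis in_set_conv_nth)
    have "dim_vec v = k" using subsetD[OF vs v] by simp
    then have "row M t = v" using len t unfolding M_def by (subst row_mat_of_row_fun) auto
    moreover have "(M *\<^sub>v c) $ t = row M t \<bullet> c" using M t len by simp
    ultimately show ?thesis using c(3) t len by simp
  qed
  show thesis
  proof (rule that[OF c(1,2)])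
    show "c $ l = 0" if "l < k" "l \<notin> I" for l
      using ann[of "unit_vec k l"] that c(1) by (auto simp: vs_def)
    show "(G *\<^sub>v c) $ j = 0" if "j \<in> J" for j
    proof -
      have "row G j \<in> set vs" using that fin by (auto simp: vs_def)
      then show ?thesis using ann[of "row G j"] that J G by auto
    qed
  qed
qed

text \<open>Two weighted sums with the same positive total weight: if every \<open>b i\<close> were
  below every \<open>a j\<close>, a number between the maximum of \<open>b\<close> and the minimum
  of \<open>a\<close> would strictly separate them.\<close>

lemma weighted_sum_le_ex:
  fixes a b p q :: "nat \<Rightarrow> real"
  assumes fin: "finite I" "finite J" and nonneg: "\<And>i. 0 \<le> p i" "\<And>j. 0 \<le> q j"
    and eq: "sum p I = sum q J" and pos: "sum p I > 0"
    and le: "(\<Sum>j\<in>J. a j * q j) \<le> (\<Sum>i\<in>I. b i * p i)"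
  shows "\<exists>i\<in>I. \<exists>j\<in>J. a j \<le> b i"
proof (rule ccontr)
  assume "\<not> ?thesis"
  then have lt: "\<And>i j. i \<in> I \<Longrightarrow> j \<in> J \<Longrightarrow> b i < a j" by force
  have ne: "I \<noteq> {}" "J \<noteq> {}" using pos eq by auto
  define \<beta> where "\<beta> = Max (b ` I)"
  define \<alpha> where "\<alpha> = Min (a ` J)"
  have "\<beta> \<in> b ` I" "\<alpha> \<in> a ` J" using fin ne by (simp_all add: \<beta>_def \<alpha>_def)
  then have "\<beta> < \<alpha>" using lt by auto
  have "(\<Sum>i\<in>I. b i * p i) \<le> (\<Sum>i\<in>I. \<beta> * p i)"
    using fin nonneg by (intro sum_mono mult_right_mono) (auto simp: \<beta>_def)
  also have "\<dots> < \<alpha> * sum q J" using \<open>\<beta> < \<alpha>\<close> pos eq by (simp flip: sum_distrib_left)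
  also have "\<dots> \<le> (\<Sum>j\<in>J. a j * q j)" unfolding sum_distrib_left
    using fin nonneg by (intro sum_mono mult_right_mono) (auto simp: \<alpha>_def)
  finally show False using le by simp
qed

text \<open>One vector is expanded in both eigenbases, with coordinates supported on
  \<open>I\<close> for the compressed pencil and vanishing on \<open>J\<close> for the full one.
  Equating its \<open>A\<close>-forms matches the total weights, and equating its
  \<open>B\<close>-forms matches the weighted sums of eigenvalues, so averaging gives both
  comparisons.\<close>

lemma compression_eigenvalue_ex_le:
  fixes A B P S R :: "complex mat"
  assumes A: "A \<in> carrier_mat n n" and B: "B \<in> carrier_mat n n" and P: "P \<in> carrier_mat n k"
    and S: "S \<in> carrier_mat n n" "mat_adjoint S * A * S = 1\<^sub>m n"
      "mat_adjoint S * B * S = mat_diag n (\<lambda>i. of_real (a i))"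
    and R: "R \<in> carrier_mat k k" "mat_adjoint R * (mat_adjoint P * A * P) * R = 1\<^sub>m k"
      "mat_adjoint R * (mat_adjoint P * B * P) * R = mat_diag k (\<lambda>i. of_real (b i))"
    and I: "I \<subseteq> {..<k}" and J: "J \<subseteq> {..<n}" and card: "card J < card I"
  shows "\<exists>i\<in>I. \<exists>j\<in>{..<n} - J. a j \<le> b i" and "\<exists>i\<in>I. \<exists>j\<in>{..<n} - J. b i \<le> a j"
proof -
  note carrier = mult_carrier_mat[of _ n n _ n] mult_carrier_mat[of _ n n _ k]
    mult_carrier_mat[of _ n k _ k] mult_carrier_mat[of _ k n _ n] mult_carrier_mat[of _ k n _ k]
  \<comment> \<open>\<open>mat_adjoint S * A\<close> inverts \<open>S\<close>, so \<open>G\<close>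
    sends coordinates in the eigenbasis of the compressed pencil to coordinates of the same vector,
    embedded by \<open>P\<close>, in the eigenbasis of the full pencil.\<close>
  define G where "G = mat_adjoint S * A * (P * R)"
  have SA: "mat_adjoint S * A \<in> carrier_mat n n" and PR: "P * R \<in> carrier_mat n k"
    using A S P R by (auto intro: carrier)
  have G: "G \<in> carrier_mat n k" unfolding G_def by (rule mult_carrier_mat[OF SA PR])
  have C: "mat_adjoint P * A * P \<in> carrier_mat k k" "mat_adjoint P * B * P \<in> carrier_mat k k"
    using A B P by (auto intro: carrier)
  obtain c where c: "c \<in> carrier_vec k" "c \<noteq> 0\<^sub>v k" "\<And>l. l < k \<Longrightarrow> l \<notin> I \<Longrightarrow> c $ l = 0"
    "\<And>j. j \<in> J \<Longrightarrow> (G *\<^sub>v c) $ j = 0"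
    using exists_vec_supported_annihilated[OF G I J card] by blast
  define y where "y = G *\<^sub>v c"
  have y: "y \<in> carrier_vec n" using G c by (simp add: y_def)
  have Rc: "R *\<^sub>v c \<in> carrier_vec k" using R c by simp
  have x: "P *\<^sub>v (R *\<^sub>v c) \<in> carrier_vec n" using P Rc by simp
  have "y = (mat_adjoint S * A) *\<^sub>v (P *\<^sub>v (R *\<^sub>v c))"
    unfolding y_def G_def assoc_mult_mat_vec[OF SA PR c(1)] assoc_mult_mat_vec[OF P R(1) c(1)] ..
  then have "S *\<^sub>v y = (S * (mat_adjoint S * A)) *\<^sub>v (P *\<^sub>v (R *\<^sub>v c))"
    using assoc_mult_mat_vec[OF S(1) SA x] by simp
  then have Sy: "S *\<^sub>v y = P *\<^sub>v (R *\<^sub>v c)"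
    using congruence_one_inverse(1)[OF A S(1,2)] x by simp
  define p where "p i = (cmod (c $ i))\<^sup>2" for i
  define q where "q j = (cmod (y $ j))\<^sup>2" for j
  have "of_real (\<Sum>j<n. a j * q j) = (B *\<^sub>v (S *\<^sub>v y)) \<bullet>c (S *\<^sub>v y)"
    using congruence_diag_scalar_prod[OF B S(1,3) y] by (simp add: q_def)
  also have "\<dots> = of_real (\<Sum>i<k. b i * p i)"
    using congruence_diag_scalar_prod[OF C(2) R(1,3) c(1)] congruence_scalar_prod[OF B P Rc Rc]
    by (simp add: Sy p_def)
  finally have sumB: "(\<Sum>j<n. a j * q j) = (\<Sum>i<k. b i * p i)" by (simp only: of_real_eq_iff)
  \<comment> \<open>Reading the identity as a diagonal matrix of ones lets the formula used for
    \<open>B\<close> evaluate the form of \<open>A\<close> as well.\<close>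
  have one: "mat_adjoint S * A * S = mat_diag n (\<lambda>i. of_real 1)"
    "mat_adjoint R * (mat_adjoint P * A * P) * R = mat_diag k (\<lambda>i. of_real 1)"
    using S R by simp_all
  have "of_real (\<Sum>j<n. q j) = (A *\<^sub>v (S *\<^sub>v y)) \<bullet>c (S *\<^sub>v y)"
    using congruence_diag_scalar_prod[OF A S(1) one(1) y] by (simp add: q_def)
  also have "\<dots> = of_real (\<Sum>i<k. p i)"
    using congruence_diag_scalar_prod[OF C(1) R(1) one(2) c(1)] congruence_scalar_prod[OF A P Rc Rc]
    by (simp add: Sy p_def)
  finally have sumA: "(\<Sum>j<n. q j) = (\<Sum>i<k. p i)" by (simp only: of_real_eq_iff)
  have I': "(\<Sum>i<k. f i * p i) = (\<Sum>i\<in>I. f i * p i)" for f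
    using I c(3) by (intro sum.mono_neutral_right) (auto simp: p_def)
  have J': "(\<Sum>j<n. f j * q j) = (\<Sum>j\<in>{..<n} - J. f j * q j)" for f
    using c(4) by (intro sum.mono_neutral_right) (auto simp: q_def y_def)
  have eq: "sum p I = sum q ({..<n} - J)"
    using sumA I'[of "\<lambda>_. 1"] J'[of "\<lambda>_. 1"] by simp
  have sumB': "(\<Sum>j\<in>{..<n} - J. a j * q j) = (\<Sum>i\<in>I. b i * p i)"
    using sumB I' J' by simp
  have fin: "finite I" "finite ({..<n} - J)" using I finite_subset by auto
  obtain i where "i < k" "c $ i \<noteq> 0" using c(1,2) by (metis carrier_vecD eq_vecI index_zero_vec)
  then have "0 < sum p {..<k}" by (intro sum_pos2[of _ i]) (auto simp: p_def)
  then have pos: "sum p I > 0" using I'[of "\<lambda>_. 1"] by simp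
  have nonneg: "0 \<le> p i" "0 \<le> q i" for i by (simp_all add: p_def q_def)
  show "\<exists>i\<in>I. \<exists>j\<in>{..<n} - J. a j \<le> b i"
    by (rule weighted_sum_le_ex[OF fin nonneg eq pos]) (simp add: sumB')
  have "\<exists>j\<in>{..<n} - J. \<exists>i\<in>I. b i \<le> a j"
    by (rule weighted_sum_le_ex[OF fin(2,1) nonneg(2,1) eq[symmetric]]) (use pos eq sumB' in auto)
  then show "\<exists>i\<in>I. \<exists>j\<in>{..<n} - J. b i \<le> a j" by blast
qed

lemma sorted_map_permutation:
  fixes f :: "nat \<Rightarrow> 'a :: linorder"
  obtains p where "p permutes {..<n}" "\<And>i. i < n \<Longrightarrow> sort (map f [0..<n]) ! i = f (p i)"
proof -
  have "mset (sort (map f [0..<n])) = mset (map f [0..<n])" by simp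
  then obtain p where p: "p permutes {..<length (map f [0..<n])}"
    "permute_list p (map f [0..<n]) = sort (map f [0..<n])"
    by (rule mset_eq_permutation)
  then have pn: "p permutes {..<n}" by simp
  show thesis
  proof (rule that[OF pn])
    fix i assume i: "i < n"
    then have "p i < n" using permutes_in_image[OF pn, of i] by simp
    then show "sort (map f [0..<n]) ! i = f (p i)"
      using i permute_list_nth[OF p(1), of i] p(2) by simp
  qed
qed

lemma compression_log_eigenvalues_interlace:
  fixes A B P S R :: "complex mat"
  assumes A: "A \<in> carrier_mat n n" and B: "positive_definite_mat n B" and P: "P \<in> carrier_mat n k"
    and PB: "positive_definite_mat k (mat_adjoint P * B * P)"
    and S: "S \<in> carrier_mat n n" "mat_adjoint S * A * S = 1\<^sub>m n"
      "mat_adjoint S * B * S = mat_diag n (\<lambda>i. of_real (a i))"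
    and R: "R \<in> carrier_mat k k" "mat_adjoint R * (mat_adjoint P * A * P) * R = 1\<^sub>m k"
      "mat_adjoint R * (mat_adjoint P * B * P) * R = mat_diag k (\<lambda>i. of_real (b i))"
    and i: "i < k" and kn: "k \<le> n"
  defines "xs \<equiv> sort (map (\<lambda>i. ln (a i)) [0..<n])" and "ys \<equiv> sort (map (\<lambda>i. ln (b i)) [0..<k])"
  shows "xs ! i \<le> ys ! i" and "ys ! i \<le> xs ! (n - k + i)"
proof -
  have B': "B \<in> carrier_mat n n" using B by (simp add: positive_definite_mat_def)
  have PA: "mat_adjoint P * A * P \<in> carrier_mat k k"
    using P A by (meson mat_adjoint_carrier mult_carrier_mat)
  have a: "a j > 0" if "j < n" for j by (rule pencil_eigenvalue_pos[OF A B S that])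
  have b: "b j > 0" if "j < k" for j by (rule pencil_eigenvalue_pos[OF PA PB R that])
  obtain p where p: "p permutes {..<n}" "\<And>i. i < n \<Longrightarrow> xs ! i = ln (a (p i))"
    unfolding xs_def by (rule sorted_map_permutation[of n "\<lambda>i. ln (a i)"]) blast
  obtain q where q: "q permutes {..<k}" "\<And>i. i < k \<Longrightarrow> ys ! i = ln (b (q i))"
    unfolding ys_def by (rule sorted_map_permutation[of k "\<lambda>i. ln (b i)"]) blast
  have card: "card (p ` J) = card J" "card (q ` J) = card J" for J
    using permutes_inj_on[OF p(1)] permutes_inj_on[OF q(1)] by (simp_all add: card_image)
  \<comment> \<open>Index sets are chosen by sorted position and carried to the unsorted eigenvalues
    by \<open>p\<close> and \<open>q\<close>; complements must be carried along too.\<close>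
  have compl: "{..<n} - p ` J = p ` ({..<n} - J)" for J
    using permutes_image[OF p(1)] image_set_diff[OF permutes_inj[OF p(1)], of "{..<n}" J] by simp
  have xs_mono: "xs ! l \<le> xs ! m" if "l \<le> m" "m < n" for l m
    using that sorted_nth_mono[of xs l m] by (simp add: xs_def)
  have ys_mono: "ys ! l \<le> ys ! m" if "l \<le> m" "m < k" for l m
    using that sorted_nth_mono[of ys l m] by (simp add: ys_def)
  have p_less: "p j < n" if "j < n" for j using that permutes_in_image[OF p(1), of j] by simp
  have q_less: "q l < k" if "l < k" for l using that permutes_in_image[OF q(1), of l] by simp
  note ex = compression_eigenvalue_ex_le[OF A B' P S R]
  show "xs ! i \<le> ys ! i"
  proof -
    \<comment> \<open>The \<open>i + 1\<close> smallest compressed eigenvalues are played against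
      \<open>i\<close> excluded full ones. The resulting positions satisfy
      \<open>l \<le> i \<le> j\<close>, and sortedness does the rest.\<close>
    have "\<exists>l\<in>q ` {..i}. \<exists>j\<in>{..<n} - p ` {..<i}. a j \<le> b l"
      by (rule ex(1)) (use i kn in \<open>auto simp: card intro!: p_less q_less\<close>)
    then obtain l j where lj: "l \<le> i" "j < n" "i \<le> j" "a (p j) \<le> b (q l)"
      unfolding compl by force
    then have "xs ! i \<le> xs ! j" by (intro xs_mono)
    also have "\<dots> \<le> ys ! l"
      using lj i p(2) q(2) a b p_less[of j] q_less[of l] by simp
    also have "\<dots> \<le> ys ! i" using lj i by (intro ys_mono)
    finally show ?thesis .
  qed
  show "ys ! i \<le> xs ! (n - k + i)"
  proof -
    \<comment> \<open>Here the \<open>k - i\<close> largest compressed eigenvalues face the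
      \<open>k - i - 1\<close> positions of the full spectrum beyond \<open>n - k + i\<close>, again
      one fewer.\<close>
    have "\<exists>l\<in>q ` {i..<k}. \<exists>j\<in>{..<n} - p ` {n - k + i + 1..<n}. b l \<le> a j"
      by (rule ex(2)) (use i kn in \<open>auto simp: card intro!: p_less q_less\<close>)
    then obtain l j where lj: "i \<le> l" "l < k" "j < n" "j \<le> n - k + i" "b (q l) \<le> a (p j)"
      unfolding compl by force
    then have "ys ! i \<le> ys ! l" by (intro ys_mono)
    also have "\<dots> \<le> xs ! j"
      using lj i p(2) q(2) a b p_less[of j] q_less[of l] by simp
    also have "\<dots> \<le> xs ! (n - k + i)" using lj i kn by (intro xs_mono) auto
    finally show ?thesis .
  qed
qed

section \<open>Contraction of the gauge distance under compression\<close>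

theorem corollary4p18:
  fixes n k :: nat
    and P A B :: "complex mat"
    and \<Phi> :: "real vec \<Rightarrow> real"
  assumes "k \<le> n"
    and "P \<in> carrier_mat n k"
    and "vec_space.rank n P = k"
    and "positive_definite_mat n A"
    and "positive_definite_mat n B"
    and "symmetric_gauge n \<Phi>"
  shows "delta_gauge n \<Phi> (mat_adjoint P * A * P) (mat_adjoint P * B * P)
           \<le> delta_gauge n \<Phi> A B"
proof -
  note kn = assms(1) and P = assms(2) and gauge = assms(6)
  have A: "A \<in> carrier_mat n n" and B: "B \<in> carrier_mat n n" "hermitian_mat B"
    using assms(4,5) by (simp_all add: positive_definite_mat_def)
  have inj: "x = 0\<^sub>v k" if "x \<in> carrier_vec k" "P *\<^sub>v x = 0\<^sub>v n" for x
    by (rule vec_space.full_rank_mult_mat_vec_inj[OF P assms(3) that])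
  have PA: "positive_definite_mat k (mat_adjoint P * A * P)"
    using positive_definite_mat_congruence[OF assms(4) P] inj by blast
  have PB: "positive_definite_mat k (mat_adjoint P * B * P)"
    using positive_definite_mat_congruence[OF assms(5) P] inj by blast
  have PA': "mat_adjoint P * A * P \<in> carrier_mat k k"
    and PB': "mat_adjoint P * B * P \<in> carrier_mat k k" "hermitian_mat (mat_adjoint P * B * P)"
    using PA PB by (simp_all add: positive_definite_mat_def)
  obtain S a where S: "S \<in> carrier_mat n n" "mat_adjoint S * A * S = 1\<^sub>m n"
    "mat_adjoint S * B * S = mat_diag n (\<lambda>i. of_real (a i))"
    using simultaneous_diagonalization[OF assms(4) B] .
  obtain R b where R: "R \<in> carrier_mat k k" "mat_adjoint R * (mat_adjoint P * A * P) * R = 1\<^sub>m k"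
    "mat_adjoint R * (mat_adjoint P * B * P) * R = mat_diag k (\<lambda>i. of_real (b i))"
    using simultaneous_diagonalization[OF PA PB'] .
  define xs where "xs = sort (map (\<lambda>i. ln (a i)) [0..<n])"
  define ys where "ys = sort (map (\<lambda>i. ln (b i)) [0..<k])"
  have len: "length xs = n" "length ys = k" by (simp_all add: xs_def ys_def)
  have xs: "log_eigenvalues A B = vec_of_list xs"
    unfolding xs_def by (rule log_eigenvalues_pencil[OF A B(1) S])
  have ys: "log_eigenvalues (mat_adjoint P * A * P) (mat_adjoint P * B * P) = vec_of_list ys"
    unfolding ys_def by (rule log_eigenvalues_pencil[OF PA' PB'(1) R])
  have le: "xs ! i \<le> ys ! i" "ys ! i \<le> xs ! (n - k + i)" if "i < k" for i
    unfolding xs_def ys_def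
    using compression_log_eigenvalues_interlace[OF A assms(5) P PB S R that kn] by blast+
  define f where "f i = (if ys ! i < 0 then i else n - k + i)" for i
  have "sorted ys" by (simp add: ys_def)
  \<comment> \<open>Negative entries form an initial segment of the sorted list. If
    \<open>ys ! j\<close> is negative, so is \<open>ys ! i\<close>, and the values are
    \<open>i < j\<close>; otherwise \<open>f j = n - k + j\<close> exceeds both possible values of
    \<open>f i\<close>.\<close>
  have lt: "f i \<noteq> f j" if "i < j" "j < k" for i j
    using that sorted_nth_mono[OF \<open>sorted ys\<close>, of i j] len by (auto simp: f_def)
  have inj: "inj_on f {..<k}"
    by (rule linorder_inj_onI) (use lt in auto)
  have "\<Phi> (zero_pad n (vec_of_list ys)) \<le> \<Phi> (vec_of_list xs)"
  proof (rule symmetric_gauge_zero_pad_le[OF gauge _ _ inj])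
    show "vec_of_list ys \<in> carrier_vec k" "vec_of_list xs \<in> carrier_vec n"
      using len by (auto intro!: carrier_vecI)
    show "f ` {..<k} \<subseteq> {..<n}" using kn by (auto simp: f_def)
    \<comment> \<open>A negative entry is bounded below by a number that is itself negative, a
      nonnegative one above by a number that is itself nonnegative, so each one-sided bound passes
      to absolute values.\<close>
    show "\<bar>vec_of_list ys $ i\<bar> \<le> \<bar>vec_of_list xs $ f i\<bar>" if "i < k" for i
      using le[OF that] that len kn by (auto simp: f_def vec_of_list_index)
  qed
  moreover have "zero_pad n (vec_of_list xs) = vec_of_list xs"
    using len by (intro zero_pad_id carrier_vecI) simp
  ultimately show ?thesis by (simp add: delta_gauge_def xs ys)
qed

end
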